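(* For every $j=1,\dots,\ell-1$, the restriction of $\dot f_j^{\,*}$ to any connected component of the type $A_{n-1}$ crystal $F(s)$ is either $0$ or an isomorphism of $A_{n-1}$-crystals (onto its image). Similarly, for every $i=1,\dots,n-1$, the restriction of ${}^*f_i$ to any connected component of the type $A_{\ell-1}$ crystal $\dot F(s)$ is either $0$ or an isomorphism of $A_{\ell-1}$-crystals.
   Context: Fix integers $n,\ell\ge2$, $s\ge0$. $F(s)$: set of $b=c_\ell\otimes\cdots\otimes c_1$ with $c_j\subseteq\{1,\dots,n\}$, $\sum|c_j|=s$; $\dot F(s)$: set of $d_1\otimes\cdots\otimes d_n$ with $d_i\subseteq\{1,\dots,\ell\}$, $\sum|d_i|=s$. Duality: $b^*=d(1)\otimes\cdots\otimes d(n)$, $d(i)=\{j:i\in c_j\}$ (bijection $F(s)\to\dot F(s)$). For $\varphi$ on $\dot F(s)$, $\varphi^*(b)=(\varphi(b^* ))^*$ (or $0$ if $\varphi(b^* )=0$); for $\psi$ on $F(s)$, ${}^*\psi(b^* )=(\psi(b))^*$ (or $0$ if $\psi(b)=0$). Crystal operators: the word of $c_\ell\otimes\cdots\otimes c_1$ concatenates the entries of $c_\ell$ (increasing), then $c_{\ell-1}$, ..., $c_1$; the word of $d_1\otimes\cdots\otimes d_n$ concatenates $d_1,\dots,d_n$. For a letter pair $(k,k+1)$, keep letters $k,k+1$ of the word, encode $k$ by $+$ and $k+1$ by $-$, delete adjacent $+-$ recursively; the lowering operator changes the $k$ of the leftmost remaining $+$ into $k+1$ (or gives $0$), the raising operator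 changes the $k+1$ of the rightmost remaining $-$ into $k$ (or gives $0$). With $k=i\in\{1,\dots,n-1\}$ on $F(s)$ this gives $f_i,e_i$ (type $A_{n-1}$); with $k=j\in\{1,\dots,\ell-1\}$ on $\dot F(s)$ this gives $\dot f_j,\dot e_j$ (type $A_{\ell-1}$). *)

theory Defs
  imports Main
begin

section \<open>Tensor products of columns and duality\<close>

text \<open>
  A tensor product of columns is a function assigning to each position its column, a finite set
  of letters, and the empty set to all other indices.  Positions are the indices used in the
  mathematical notation: \<open>c\<^sub>\<ell> \<otimes> \<dots> \<otimes> c\<^sub>1\<close> is the function \<open>j \<mapsto> c\<^sub>j\<close> and \<open>d\<^sub>1 \<otimes> \<dots> \<otimes> d\<^sub>n\<close> is the function
  \<open>i \<mapsto> d\<^sub>i\<close>.  The order in which the factors are written enters only through the list of positions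
  passed to \<open>tensor_word\<close> below.
\<close>

type_synonym columns = "nat \<Rightarrow> nat set"

definition column_products :: "nat \<Rightarrow> nat \<Rightarrow> nat \<Rightarrow> columns set" where
  "column_products m n s =
     {b. (\<forall>p\<in>{1..m}. b p \<subseteq> {1..n}) \<and> (\<forall>p. p \<notin> {1..m} \<longrightarrow> b p = {}) \<and> (\<Sum>p=1..m. card (b p)) = s}"

definition F_set :: "nat \<Rightarrow> nat \<Rightarrow> nat \<Rightarrow> columns set" where
  "F_set n l s = column_products l n s"

definition Fdot_set :: "nat \<Rightarrow> nat \<Rightarrow> nat \<Rightarrow> columns set" where
  "Fdot_set n l s = column_products n l s"

definition dual :: "columns \<Rightarrow> columns" where
  "dual b = (\<lambda>i. {j. i \<in> b j})"

lemma dual_dual [simp]: "dual (dual b) = b"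
  by (simp add: dual_def)

lemma dual_column_products:
  assumes "b \<in> column_products m n s"
  shows "dual b \<in> column_products n m s"
proof -
  have sub: "b p \<subseteq> {1..n}" for p
    using assms by (cases "p \<in> {1..m}") (auto simp: column_products_def)
  have out: "p \<in> {1..m}" if "x \<in> b p" for p x
    using assms that by (fastforce simp: column_products_def)
  have fin: "finite (b p)" for p
    using sub finite_subset by blast
  have "(\<Sum>i=1..n. card {j. i \<in> b j}) = (\<Sum>i=1..n. card {j \<in> {1..m}. i \<in> b j})"
    using out by (intro sum.cong arg_cong[where f = card]) auto
  also have "\<dots> = (\<Sum>i=1..n. \<Sum>j=1..m. if i \<in> b j then 1 else 0)"
    by (intro sum.cong refl) (simp add: sum.If_cases Int_def)
  also have "\<dots> = (\<Sum>j=1..m. \<Sum>i=1..n. if i \<in> b j then 1 else 0)"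
    by (rule sum.swap)
  also have "\<dots> = (\<Sum>j=1..m. card (b j))"
  proof (intro sum.cong refl)
    fix j
    have "{1..n} \<inter> {i. i \<in> b j} = b j" using sub[of j] by auto
    then show "(\<Sum>i=1..n. if i \<in> b j then 1 else 0) = card (b j)"
      by (simp add: sum.If_cases)
  qed
  also have "\<dots> = s" using assms by (simp add: column_products_def)
  finally show ?thesis
    using sub out by (fastforce simp: column_products_def dual_def)
qed

lemma bij_betw_dual: "bij_betw dual (F_set n l s) (Fdot_set n l s)"
  by (rule bij_betw_byWitness[where f' = dual])
     (auto simp: F_set_def Fdot_set_def intro: dual_column_products)

text \<open>
  Transport of an operator along duality; \<open>None\<close> stands for \<open>0\<close>.  Since \<open>dual\<close> is its own inverse
  as a map on \<open>columns\<close>, the same formula gives both \<open>\<phi>\<^sup>*\<close> and \<open>\<^sup>*\<psi>\<close>.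
\<close>

definition dual_op :: "(columns \<Rightarrow> columns option) \<Rightarrow> columns \<Rightarrow> columns option" where
  "dual_op \<phi> b = map_option dual (\<phi> (dual b))"

lemma dual_op_dual: "dual_op \<psi> (dual b) = map_option dual (\<psi> b)"
  by (simp add: dual_op_def)


section \<open>Words and the signature rule\<close>

text \<open>
  The word is read off the positions in the given order.  Each letter is paired with the position
  it comes from, so that changing a letter of the word can be carried out in its column.
\<close>

definition tensor_word :: "nat list \<Rightarrow> columns \<Rightarrow> (nat \<times> nat) list" where
  "tensor_word ps b = concat (map (\<lambda>p. map (\<lambda>x. (p, x)) (sorted_list_of_set (b p))) ps)"

text \<open>
  The letter \<open>k\<close> plays the role of \<open>+\<close> and \<open>k + 1\<close> that of \<open>-\<close>; \<open>reduce\<close> deletes adjacent \<open>+-\<close>,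
  scanning the word from its right end.
\<close>

fun push :: "nat \<Rightarrow> nat \<times> nat \<Rightarrow> (nat \<times> nat) list \<Rightarrow> (nat \<times> nat) list" where
  "push k a [] = [a]"
| "push k a (c # w) = (if snd a = k \<and> snd c = Suc k then w else a # c # w)"

definition reduce :: "nat \<Rightarrow> (nat \<times> nat) list \<Rightarrow> (nat \<times> nat) list" where
  "reduce k w = foldr (push k) w []"

text \<open>
  Any way of deleting adjacent \<open>+-\<close> until no such pair is left produces \<open>reduce k w\<close>.
\<close>

inductive delete_pair :: "nat \<Rightarrow> (nat \<times> nat) list \<Rightarrow> (nat \<times> nat) list \<Rightarrow> bool" for k where
  "delete_pair k (u @ (p, k) # (q, Suc k) # v) (u @ v)"

lemma delete_pair_Cons: "delete_pair k w w' \<Longrightarrow> delete_pair k (a # w) (a # w')"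
  by (auto simp: delete_pair.simps intro: exI[of _ "a # _"] elim!: delete_pair.cases)
     (metis append_Cons)

lemma delete_pairs_reduce: "(delete_pair k)\<^sup>*\<^sup>* w (reduce k w)"
proof (induction w)
  case Nil
  show ?case by (simp add: reduce_def)
next
  case (Cons a w)
  have "(delete_pair k)\<^sup>*\<^sup>* (a # w) (a # reduce k w)"
    using Cons by (induction rule: rtranclp_induct)
      (auto intro: rtranclp.rtrancl_into_rtrancl delete_pair_Cons)
  moreover have "(delete_pair k)\<^sup>*\<^sup>* (a # v) (push k a v)" for v
  proof (cases v)
    case (Cons c v')
    have "delete_pair k ([] @ (fst a, k) # (fst c, Suc k) # v') ([] @ v')"
      by (rule delete_pair.intros)
    then show ?thesis using Cons by (cases a; cases c) auto
  qed simp
  ultimately show ?case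
    by (auto simp: reduce_def intro: rtranclp_trans)
qed

lemma push_normal:
  assumes "\<not> (\<exists>v. delete_pair k w v)"
  shows "\<not> (\<exists>v. delete_pair k (push k a w) v)"
proof (cases w)
  case Nil
  then show ?thesis by (auto simp: delete_pair.simps Cons_eq_append_conv)
next
  case (Cons c w')
  have "\<not> delete_pair k w' v" for v
    using assms delete_pair_Cons[of k w' v c] Cons by blast
  moreover have "\<not> delete_pair k (a # w) v" if "\<not> (snd a = k \<and> snd c = Suc k)" for v
  proof
    assume "delete_pair k (a # w) v"
    then obtain u p q v' where *: "a # w = u @ (p, k) # (q, Suc k) # v'"
      by (auto elim: delete_pair.cases)
    show False
    proof (cases u)
      case Nil
      then show False using * Cons that by auto
    next
      case (Cons x u')
      then have "delete_pair k w (u' @ v')"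
        using * by (auto intro: delete_pair.intros)
      then show False using assms by blast
    qed
  qed
  ultimately show ?thesis using Cons by auto
qed

lemma reduce_normal: "\<not> delete_pair k (reduce k w) v"
proof -
  have "\<not> (\<exists>v. delete_pair k (reduce k w) v)"
  proof (induction w)
    case Nil
    show ?case by (auto simp: reduce_def delete_pair.simps)
  next
    case (Cons a w)
    then show ?case using push_normal[of k "reduce k w" a] by (simp add: reduce_def)
  qed
  then show ?thesis by blast
qed

lemma reduce_delete_pair:
  assumes "delete_pair k w w'"
  shows "reduce k w = reduce k w'"
proof -
  have "push k (p, k) (push k (q, Suc k) v) = v" for p q v
    by (cases v) auto
  with assms show ?thesis by (auto simp: reduce_def elim!: delete_pair.cases)
qed

definition remaining :: "nat list \<Rightarrow> nat \<Rightarrow> columns \<Rightarrow> (nat \<times> nat) list" where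
  "remaining ps k b = reduce k (filter (\<lambda>(p, x). x = k \<or> x = Suc k) (tensor_word ps b))"

definition lowering :: "nat list \<Rightarrow> nat \<Rightarrow> columns \<Rightarrow> columns option" where
  "lowering ps k b =
     (case filter (\<lambda>(p, x). x = k) (remaining ps k b) of
        [] \<Rightarrow> None
      | (p, x) # _ \<Rightarrow> Some (b(p := insert (Suc k) (b p - {k}))))"

definition raising :: "nat list \<Rightarrow> nat \<Rightarrow> columns \<Rightarrow> columns option" where
  "raising ps k b =
     (case rev (filter (\<lambda>(p, x). x = Suc k) (remaining ps k b)) of
        [] \<Rightarrow> None
      | (p, x) # _ \<Rightarrow> Some (b(p := insert k (b p - {Suc k}))))"

text \<open>Reading orders of \<open>c\<^sub>\<ell> \<otimes> \<dots> \<otimes> c\<^sub>1\<close> and of \<open>d\<^sub>1 \<otimes> \<dots> \<otimes> d\<^sub>n\<close>.\<close>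

abbreviation F_order :: "nat \<Rightarrow> nat list" where
  "F_order l \<equiv> rev [1..<Suc l]"

abbreviation Fdot_order :: "nat \<Rightarrow> nat list" where
  "Fdot_order n \<equiv> [1..<Suc n]"

text \<open>The crystal operators \<open>f\<^sub>i\<close>, \<open>e\<^sub>i\<close> on \<open>F(s)\<close> and their dotted counterparts.\<close>

definition f_op :: "nat \<Rightarrow> nat \<Rightarrow> columns \<Rightarrow> columns option" where
  "f_op l i = lowering (F_order l) i"

definition e_op :: "nat \<Rightarrow> nat \<Rightarrow> columns \<Rightarrow> columns option" where
  "e_op l i = raising (F_order l) i"

definition fdot_op :: "nat \<Rightarrow> nat \<Rightarrow> columns \<Rightarrow> columns option" where
  "fdot_op n j = lowering (Fdot_order n) j"

definition edot_op :: "nat \<Rightarrow> nat \<Rightarrow> columns \<Rightarrow> columns option" where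
  "edot_op n j = raising (Fdot_order n) j"


section \<open>Crystals\<close>

record ('b, 'w) crystal =
  cr_index :: "nat set"
  cr_elems :: "'b set"
  cr_wt :: "'b \<Rightarrow> 'w"
  cr_e :: "nat \<Rightarrow> 'b \<Rightarrow> 'b option"
  cr_f :: "nat \<Rightarrow> 'b \<Rightarrow> 'b option"

text \<open>\<open>\<epsilon>\<^sub>i(b) = max {k. e\<^sub>i\<^sup>k b \<noteq> 0}\<close> and \<open>\<phi>\<^sub>i(b) = max {k. f\<^sub>i\<^sup>k b \<noteq> 0}\<close>.\<close>

definition string_length :: "('b \<Rightarrow> 'b option) \<Rightarrow> 'b \<Rightarrow> nat" where
  "string_length g b = (GREATEST k. ((\<lambda>x. Option.bind x g) ^^ k) (Some b) \<noteq> None)"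

definition cr_eps :: "('b, 'w) crystal \<Rightarrow> nat \<Rightarrow> 'b \<Rightarrow> nat" where
  "cr_eps X i b = string_length (cr_e X i) b"

definition cr_phi :: "('b, 'w) crystal \<Rightarrow> nat \<Rightarrow> 'b \<Rightarrow> nat" where
  "cr_phi X i b = string_length (cr_f X i) b"

definition cr_edges :: "('b, 'w) crystal \<Rightarrow> ('b \<times> 'b) set" where
  "cr_edges X = {(b, b'). b \<in> cr_elems X \<and> b' \<in> cr_elems X \<and> (\<exists>i\<in>cr_index X. cr_f X i b = Some b')}"

definition connected_components :: "('b, 'w) crystal \<Rightarrow> 'b set set" where
  "connected_components X = cr_elems X // (cr_edges X \<union> (cr_edges X)\<inverse>)\<^sup>*"

definition subcrystal :: "('b, 'w) crystal \<Rightarrow> 'b set \<Rightarrow> bool" where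
  "subcrystal X A \<longleftrightarrow> A \<subseteq> cr_elems X \<and>
     (\<forall>i\<in>cr_index X. \<forall>b\<in>A. set_option (cr_e X i b) \<subseteq> A \<and> set_option (cr_f X i b) \<subseteq> A)"

definition crystal_isomorphism ::
  "('b, 'w) crystal \<Rightarrow> ('c, 'w) crystal \<Rightarrow> ('b \<Rightarrow> 'c) \<Rightarrow> bool" where
  "crystal_isomorphism X Y g \<longleftrightarrow>
     cr_index X = cr_index Y \<and>
     bij_betw g (cr_elems X) (cr_elems Y) \<and>
     (\<forall>b\<in>cr_elems X. cr_wt Y (g b) = cr_wt X b) \<and>
     (\<forall>i\<in>cr_index X. \<forall>b\<in>cr_elems X.
        cr_eps Y i (g b) = cr_eps X i b \<and>
        cr_phi Y i (g b) = cr_phi X i b \<and>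
        cr_e Y i (g b) = map_option g (cr_e X i b) \<and>
        cr_f Y i (g b) = map_option g (cr_f X i b))"

text \<open>
  For a map \<open>\<psi>\<close> with values in \<open>X \<squnion> {0}\<close>: \<open>\<psi>\<close> does not take the value \<open>0\<close> on \<open>C\<close>, its image is a
  subcrystal of \<open>X\<close>, and \<open>\<psi>\<close> is an isomorphism from \<open>C\<close> to this image, both with the structure of \<open>X\<close>.
\<close>

definition isomorphism_onto_image ::
  "('b, 'w) crystal \<Rightarrow> 'b set \<Rightarrow> ('b \<Rightarrow> 'b option) \<Rightarrow> bool" where
  "isomorphism_onto_image X C \<psi> \<longleftrightarrow>
     (\<forall>b\<in>C. \<psi> b \<noteq> None) \<and>
     subcrystal X ((\<lambda>b. the (\<psi> b)) ` C) \<and>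
     crystal_isomorphism (X\<lparr>cr_elems := C\<rparr>) (X\<lparr>cr_elems := (\<lambda>b. the (\<psi> b)) ` C\<rparr>) (\<lambda>b. the (\<psi> b))"

text \<open>
  The weight is the content, i.e. the exponent vector \<open>k \<mapsto> #k\<close> of the word.  As the total number
  of letters is fixed to be \<open>s\<close>, two elements have the same content iff their contents agree
  modulo \<open>(1,\<dots>,1)\<close>, i.e. iff they have the same type A weight.
\<close>

definition content :: "nat list \<Rightarrow> columns \<Rightarrow> nat \<Rightarrow> nat" where
  "content ps b k = count_list (map snd (tensor_word ps b)) k"

definition F_crystal :: "nat \<Rightarrow> nat \<Rightarrow> nat \<Rightarrow> (columns, nat \<Rightarrow> nat) crystal" where
  "F_crystal n l s =
     \<lparr>cr_index = {1..n-1}, cr_elems = F_set n l s, cr_wt = content (F_order l),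
      cr_e = e_op l, cr_f = f_op l\<rparr>"

definition Fdot_crystal :: "nat \<Rightarrow> nat \<Rightarrow> nat \<Rightarrow> (columns, nat \<Rightarrow> nat) crystal" where
  "Fdot_crystal n l s =
     \<lparr>cr_index = {1..l-1}, cr_elems = Fdot_set n l s, cr_wt = content (Fdot_order n),
      cr_e = edot_op n, cr_f = fdot_op n\<rparr>"

end

theory Submission
  imports Defs
begin

text \<open>
  View an element of \<open>F(s)\<close> as a 0-1 matrix with \<open>\<ell>\<close> rows and \<open>n\<close> columns: \<open>f\<^sub>i\<close> moves an entry 1 from
  column \<open>i\<close> to column \<open>i + 1\<close> within a row, and the transported dotted operator moves one from row \<open>j\<close>
  to row \<open>j + 1\<close> within a column.  Both obey the tensor product rule, so their interaction takes
  place in the block of rows \<open>j\<close>, \<open>j + 1\<close> and columns \<open>i\<close>, \<open>i + 1\<close>: there each operator preserves the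
  numbers of \<open>+\<close> and \<open>-\<close> surviving in the reduced signature of the other, and the two commute.  Hence
  these numbers are preserved for the whole matrix, so that definedness is constant on components,
  and the operators commute wherever both are defined.  As raising and lowering operators are partial
  inverses of each other, the transported operator commutes with the raising operators as well.
\<close>

section \<open>The reduced signature\<close>

definition move :: "nat \<Rightarrow> nat \<Rightarrow> nat \<Rightarrow> columns \<Rightarrow> columns" where
  "move x y p b = b(p := insert y (b p - {x}))"

lemma move_other [simp]: "q \<noteq> p \<Longrightarrow> move x y p b q = b q"
  by (simp add: move_def)

lemma move_same [simp]: "move x y p b p = insert y (b p - {x})"
  by (simp add: move_def)

lemma move_inverse: "x \<in> b p \<Longrightarrow> y \<notin> b p \<Longrightarrow> move y x p (move x y p b) = b"
  by (simp add: move_def insert_absorb)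

lemma mem_dual [simp]: "x \<in> dual b p \<longleftrightarrow> p \<in> b x"
  by (simp add: dual_def)

lemma dual_inject: "dual b = dual c \<Longrightarrow> b = c"
  by (metis dual_dual)

text \<open>
  The positions of the \<open>-\<close> and of the \<open>+\<close> in the reduced word.  A position holding both \<open>k\<close> and \<open>k + 1\<close>
  contributes the cancelling pair \<open>+-\<close>, so it is skipped.
\<close>

fun minuses :: "nat \<Rightarrow> nat list \<Rightarrow> columns \<Rightarrow> nat list" where
  "minuses k [] b = []"
| "minuses k (p # ps) b =
     (if k \<in> b p \<longleftrightarrow> Suc k \<in> b p then minuses k ps b
      else if Suc k \<in> b p then p # minuses k ps b
      else tl (minuses k ps b))"

text \<open>A \<open>+\<close> read in front of a reduced rest \<open>-...-+...+\<close> survives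
  only if the rest has no \<open>-\<close>; otherwise it removes the first one, which is the
  \<open>tl\<close> in \<open>minuses\<close>. The value \<open>tl [] = []\<close> covers the
  surviving case.\<close>

fun pluses :: "nat \<Rightarrow> nat list \<Rightarrow> columns \<Rightarrow> nat list" where
  "pluses k [] b = []"
| "pluses k (p # ps) b =
     (if k \<in> b p \<and> Suc k \<notin> b p \<and> minuses k ps b = [] then p # pluses k ps b
      else pluses k ps b)"

lemma set_minuses: "p \<in> set (minuses k ps b) \<Longrightarrow> p \<in> set ps \<and> k \<notin> b p \<and> Suc k \<in> b p"
proof (induction ps)
  case (Cons a ps)
  then show ?case by (cases "minuses k ps b") (auto split: if_splits)
qed simp

lemma set_pluses: "p \<in> set (pluses k ps b) \<Longrightarrow> p \<in> set ps \<and> k \<in> b p \<and> Suc k \<notin> b p"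
  by (induction ps) (auto split: if_splits)

lemma signature_cong:
  assumes "\<And>p. p \<in> set ps \<Longrightarrow> (k \<in> b p \<longleftrightarrow> k \<in> c p) \<and> (Suc k \<in> b p \<longleftrightarrow> Suc k \<in> c p)"
  shows "minuses k ps b = minuses k ps c" "pluses k ps b = pluses k ps c"
proof -
  have "minuses k ps b = minuses k ps c \<and> pluses k ps b = pluses k ps c"
    using assms by (induction ps) simp_all
  then show "minuses k ps b = minuses k ps c" "pluses k ps b = pluses k ps c" by simp_all
qed

text \<open>Together with \<open>pluses_append\<close> this is the tensor product rule: the
  \<open>+\<close> surviving in \<open>us\<close>, rightmost first, cancel against the leftmost
  \<open>-\<close> surviving in \<open>vs\<close>. How much is cut depends only on the numbers of
  survivors, which is what permits localization.\<close>

lemma minuses_append: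
  "minuses k (us @ vs) b = minuses k us b @ drop (length (pluses k us b)) (minuses k vs b)"
  by (induction us) (auto simp: tl_drop drop_Suc split: list.splits)

lemma pluses_append:
  "pluses k (us @ vs) b =
     take (length (pluses k us b) - length (minuses k vs b)) (pluses k us b) @ pluses k vs b"
proof (induction us)
  case (Cons a us)
  show ?case
  proof (cases "k \<in> b a \<and> Suc k \<notin> b a \<and> minuses k us b = []")
    case True
    \<comment> \<open>The \<open>+\<close> at \<open>a\<close> survives iff \<open>us\<close>
      already cancels every \<open>-\<close> of \<open>vs\<close>; otherwise both truncated
      differences are 0.\<close>
    then show ?thesis
      using Cons by (cases "length (minuses k vs b) \<le> length (pluses k us b)")
        (simp_all add: minuses_append Suc_diff_le)
  next
    case False
    then have "pluses k (a # us) b = pluses k us b" "pluses k ((a # us) @ vs) b = pluses k (us @ vs) b"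
      by (auto simp: minuses_append)
    then show ?thesis using Cons by simp
  qed
qed simp

section \<open>Crystal operators in terms of the signature\<close>

lemma filter_two_sorted_list_of_set:
  assumes "finite A"
  shows "filter (\<lambda>x. x = k \<or> x = Suc k) (sorted_list_of_set A) =
    (if k \<in> A then [k] else []) @ (if Suc k \<in> A then [Suc k] else [])"
  by (rule sorted_distinct_set_unique) (use assms in \<open>auto simp: sorted_wrt_filter\<close>)

text \<open>Columns are read increasingly, so one with both letters contributes \<open>+-\<close>,
  which \<open>push\<close> deletes at once; the other patterns match the clauses of
  \<open>minuses\<close> and \<open>pluses\<close>. Finiteness matters because
  \<open>sorted_list_of_set\<close> is empty on infinite sets.\<close>

lemma remaining_eq:
  assumes "\<forall>p. finite (b p)"
  shows "remaining ps k b =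
    map (\<lambda>p. (p, Suc k)) (minuses k ps b) @ map (\<lambda>p. (p, k)) (pluses k ps b)"
proof (induction ps)
  case Nil
  show ?case by (simp add: remaining_def reduce_def tensor_word_def)
next
  case (Cons a ps)
  have flt: "filter (\<lambda>(p, x). x = k \<or> x = Suc k) (map (Pair a) xs) =
      map (Pair a) (filter (\<lambda>x. x = k \<or> x = Suc k) xs)" for xs
    by (simp add: filter_map o_def)
  have "remaining (a # ps) k b =
      foldr (push k) (map (Pair a) ((if k \<in> b a then [k] else []) @
        (if Suc k \<in> b a then [Suc k] else []))) (remaining ps k b)"
    using filter_two_sorted_list_of_set[of "b a" k] assms
    by (simp add: remaining_def reduce_def tensor_word_def flt)
  then show ?case
    by (cases "k \<in> b a"; cases "Suc k \<in> b a"; cases "minuses k ps b"; cases "pluses k ps b")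
       (simp_all add: Cons)
qed

lemma lowering_eq:
  assumes "\<forall>p. finite (b p)"
  shows "lowering ps k b =
    (case pluses k ps b of [] \<Rightarrow> None | p # _ \<Rightarrow> Some (move k (Suc k) p b))"
  by (cases "pluses k ps b")
     (auto simp: lowering_def remaining_eq[OF assms] filter_map o_def move_def split: list.splits)

lemma raising_eq:
  assumes "\<forall>p. finite (b p)"
  shows "raising ps k b =
    (if minuses k ps b = [] then None else Some (move (Suc k) k (last (minuses k ps b)) b))"
  by (cases "minuses k ps b" rule: rev_cases)
     (auto simp: raising_def remaining_eq[OF assms] filter_map o_def move_def split: list.splits)

lemma lowering_Some_iff:
  assumes "\<forall>p. finite (b p)"
  shows "lowering ps k b = Some c \<longleftrightarrow>
    (\<exists>p q. pluses k ps b = p # q \<and> c = move k (Suc k) p b)"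
  by (auto simp: lowering_eq[OF assms] split: list.splits)

lemma lowering_None_iff:
  assumes "\<forall>p. finite (b p)"
  shows "lowering ps k b = None \<longleftrightarrow> pluses k ps b = []"
  by (auto simp: lowering_eq[OF assms] split: list.splits)

lemma raising_None_iff:
  assumes "\<forall>p. finite (b p)"
  shows "raising ps k b = None \<longleftrightarrow> minuses k ps b = []"
  by (auto simp: raising_eq[OF assms])

lemma raising_Some_iff:
  assumes "\<forall>p. finite (b p)"
  shows "raising ps k b = Some c \<longleftrightarrow>
    (\<exists>m p. minuses k ps b = m @ [p] \<and> c = move (Suc k) k p b)"
  by (cases "minuses k ps b" rule: rev_cases) (auto simp: raising_eq[OF assms])

text \<open>The leftmost surviving \<open>+\<close> follows the last surviving \<open>-\<close>, so
  flipping it shifts the boundary in \<open>-...-+...+\<close> by one. Distinctness ensures that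
  only one entry of \<open>ps\<close> is affected.\<close>

lemma signature_move_down:
  assumes "distinct ps" "pluses k ps b = p # q"
  shows "minuses k ps (move k (Suc k) p b) = minuses k ps b @ [p] \<and>
    pluses k ps (move k (Suc k) p b) = q"
  using assms
proof (induction ps)
  case (Cons a ps)
  show ?case
  proof (cases "k \<in> b a \<and> Suc k \<notin> b a \<and> minuses k ps b = []")
    case True
    then have "p = a" "q = pluses k ps b" using Cons.prems by auto
    moreover from this have "minuses k ps (move k (Suc k) p b) = minuses k ps b"
        "pluses k ps (move k (Suc k) p b) = pluses k ps b"
      using Cons.prems by (metis distinct.simps(2) move_other signature_cong)+
    ultimately show ?thesis using True by simp
  next
    case False
    then have eq: "pluses k ps b = p # q" using Cons.prems by auto
    then have "p \<in> set ps" using set_pluses[of p k ps b] by simp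
    then have "a \<noteq> p" using Cons.prems by auto
    \<comment> \<open>A \<open>+\<close> at \<open>a\<close> meets a nonempty
      \<open>minuses k ps b\<close> here, so \<open>tl\<close> does not reach the appended
      \<open>p\<close>.\<close>
    with Cons eq False show ?thesis by (auto simp: tl_append split: list.splits)
  qed
qed simp

lemma signature_move_up:
  assumes "distinct ps" "minuses k ps b = m @ [p]"
  shows "minuses k ps (move (Suc k) k p b) = m \<and>
    pluses k ps (move (Suc k) k p b) = p # pluses k ps b"
  using assms
proof (induction ps arbitrary: m)
  case (Cons a ps)
  show ?case
  proof (cases "k \<notin> b a \<and> Suc k \<in> b a \<and> minuses k ps b = []")
    case True
    then have "p = a" "m = []" using Cons.prems by auto
    moreover from this have "minuses k ps (move (Suc k) k p b) = minuses k ps b"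
        "pluses k ps (move (Suc k) k p b) = pluses k ps b"
      using Cons.prems by (metis distinct.simps(2) move_other signature_cong)+
    ultimately show ?thesis using True by simp
  next
    case False
    then obtain m' where eq: "minuses k ps b = m' @ [p]"
      using Cons.prems by (cases "minuses k ps b" rule: rev_cases)
        (auto simp: tl_append split: if_splits list.splits)
    then have "p \<in> set ps" using set_minuses[of p k ps b] by simp
    then have "a \<noteq> p" using Cons.prems by auto
    \<comment> \<open>As \<open>p\<close> survives, a \<open>+\<close> at \<open>a\<close> must have
      cancelled an entry of \<open>m'\<close>; it still does so after \<open>p\<close> is
      flipped.\<close>
    with Cons.prems Cons.IH[OF _ eq] eq False show ?thesis
      by (cases m') (auto split: if_splits)
  qed
qed simp

text \<open>A flipped position passes from the head of \<open>pluses\<close> to the end of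
  \<open>minuses\<close> or back, which is exactly where the opposite operator acts.\<close>

lemma lowering_raising_iff:
  assumes "distinct ps" and b: "\<forall>p. finite (b p)" and c: "\<forall>p. finite (c p)"
  shows "lowering ps k b = Some c \<longleftrightarrow> raising ps k c = Some b"
proof
  assume "lowering ps k b = Some c"
  then obtain p q where pq: "pluses k ps b = p # q" "c = move k (Suc k) p b"
    by (auto simp: lowering_Some_iff[OF b])
  then have "b = move (Suc k) k p c"
    using set_pluses[of p k ps b] by (simp add: move_inverse)
  then show "raising ps k c = Some b"
    using signature_move_down[OF assms(1) pq(1), folded pq(2)] unfolding raising_Some_iff[OF c] by blast
next
  assume "raising ps k c = Some b"
  then obtain m p where mp: "minuses k ps c = m @ [p]" "b = move (Suc k) k p c"
    by (auto simp: raising_Some_iff[OF c])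
  then have "c = move k (Suc k) p b"
    using set_minuses[of p k ps c] by (simp add: move_inverse)
  then show "lowering ps k b = Some c"
    using signature_move_up[OF assms(1) mp(1), folded mp(2)] unfolding lowering_Some_iff[OF b] by blast
qed


section \<open>Localization to a two by two block\<close>

text \<open>Each factor contributes a prefix of its own surviving \<open>+\<close>. If the first one
  overall lies in \<open>vs\<close>, it heads a nonempty prefix, hence also the list of
  \<open>vs\<close> alone.\<close>

lemma hd_pluses_block:
  assumes "distinct (us @ vs @ ts)" "pluses k (us @ vs @ ts) b = p # q" "p \<in> set vs"
  shows "\<exists>q'. pluses k vs b = p # q'"
proof -
  let ?U = "take (length (pluses k us b) - length (minuses k (vs @ ts) b)) (pluses k us b)"
  let ?V = "take (length (pluses k vs b) - length (minuses k ts b)) (pluses k vs b)"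
  have eq: "?U @ ?V @ pluses k ts b = p # q"
    using assms(2) by (simp add: pluses_append)
  have "p \<notin> set (pluses k us b)" and ts: "p \<notin> set (pluses k ts b)"
    using assms set_pluses[of p k] by fastforce+
  then have "p \<notin> set ?U" by (blast dest: in_set_takeD)
  then have U: "?U = []" using eq by (cases ?U) auto
  show ?thesis
  proof (cases ?V)
    case Nil
    then have "pluses k ts b = p # q" using eq unfolding U Nil by simp
    then show ?thesis using ts by simp
  next
    case (Cons v V)
    then have "?V = p # V" using eq unfolding U by simp
    then show ?thesis by (cases "pluses k vs b") (auto simp: take_Cons' split: if_splits)
  qed
qed

context
  fixes us vs ts :: "nat list" and k :: nat and b c :: columns
  assumes outside: "\<And>p. p \<in> set us \<union> set ts \<Longrightarrow>
      (k \<in> b p \<longleftrightarrow> k \<in> c p) \<and> (Suc k \<in> b p \<longleftrightarrow> Suc k \<in> c p)"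
    and lengths: "length (minuses k vs b) = length (minuses k vs c)"
      "length (pluses k vs b) = length (pluses k vs c)"
begin

lemma length_signature_block:
  "length (minuses k (us @ vs @ ts) b) = length (minuses k (us @ vs @ ts) c)"
  "length (pluses k (us @ vs @ ts) b) = length (pluses k (us @ vs @ ts) c)"
  using lengths signature_cong[of us k b c] signature_cong[of ts k b c] outside
  by (auto simp: minuses_append pluses_append)

text \<open>The cuts made by the tensor product rule depend only on lengths, so they are the same
  for \<open>b\<close> and \<open>c\<close>, and so is the factor acted on. Outside
  \<open>vs\<close> the position agrees as well; inside, it is the one prescribed by the block of
  \<open>c\<close> alone.\<close>

lemma hd_pluses_block_cong:
  assumes "distinct (us @ vs @ ts)" "pluses k (us @ vs @ ts) b = p # q"
  shows "\<exists>p' q'. pluses k (us @ vs @ ts) c = p' # q' \<and>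
    (if p \<in> set vs then \<exists>q''. pluses k vs c = p' # q'' else p' = p)"
proof -
  have eq: "minuses k us c = minuses k us b" "pluses k us c = pluses k us b"
      "minuses k ts c = minuses k ts b" "pluses k ts c = pluses k ts b"
    using signature_cong[of us k b c] signature_cong[of ts k b c] outside by auto
  let ?U = "take (length (pluses k us b) - length (minuses k (vs @ ts) b)) (pluses k us b)"
  let ?V = "\<lambda>b. take (length (pluses k vs b) - length (minuses k ts b)) (pluses k vs b)"
  have lenm: "length (minuses k (vs @ ts) c) = length (minuses k (vs @ ts) b)"
    using lengths eq by (simp add: minuses_append)
  have b: "pluses k (us @ vs @ ts) b = ?U @ ?V b @ pluses k ts b"
    by (simp add: pluses_append)
  have c: "pluses k (us @ vs @ ts) c = ?U @ ?V c @ pluses k ts b"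
    using lenm eq by (simp add: pluses_append)
  have lenV: "length (?V c) = length (?V b)" using lengths eq by simp
  have disj: "set ?U \<subseteq> set us" "set (?V b) \<subseteq> set vs" "set (pluses k ts b) \<subseteq> set ts"
    using set_pluses by (fastforce dest: in_set_takeD)+
  show ?thesis
  proof (cases ?U)
    case (Cons u U)
    then have "p = u" using b assms by simp
    moreover have "u \<in> set us" using disj(1) Cons by (metis list.set_intros(1) subsetD)
    ultimately show ?thesis using c assms Cons by auto
  next
    case U: Nil
    show ?thesis
    proof (cases "?V b")
      case (Cons v V)
      then have pv: "p \<in> set vs" using b assms disj(2) U by auto
      obtain v' V' where V': "?V c = v' # V'"
        using lenV Cons by (cases "?V c") auto
      then have "\<exists>q''. pluses k vs c = v' # q''"
        by (cases "pluses k vs c") (auto simp: take_Cons' split: if_splits)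
      with V' c U pv show ?thesis by auto
    next
      case Nil
      then have V0: "?V c = []" using lenV by (metis length_0_conv)
      have "pluses k ts b = p # q" using b assms(2) U Nil by simp
      then have "p \<in> set ts" using disj(3) by simp
      then have "p \<notin> set vs" using assms(1) by auto
      moreover have "pluses k (us @ vs @ ts) c = p # q"
        using V0 U c \<open>pluses k ts b = p # q\<close> by simp
      ultimately show ?thesis by simp
    qed
  qed
qed

end

text \<open>
  The rows \<open>j\<close>, \<open>j + 1\<close> are read in decreasing and the columns \<open>i\<close>, \<open>i + 1\<close> in increasing order; in each
  of the sixteen cases the assertion about the block is checked directly.
\<close>

context
  fixes ps qs us ts us' ts' :: "nat list" and i j :: nat
  assumes ps: "ps = us @ [Suc j, j] @ ts" "distinct ps"
    and qs: "qs = us' @ [i, Suc i] @ ts'" "distinct qs"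
begin

text \<open>The opposite reading orders enter here. If row \<open>j\<close> contains
  \<open>i\<close> and \<open>Suc i\<close> and row \<open>Suc j\<close> neither, a move inside the
  block takes column \<open>i\<close> and creates the cancelling \<open>+-\<close>; taking column
  \<open>Suc i\<close> would leave \<open>-+\<close>. A move in another column does not touch the
  block.\<close>

lemma length_signature_row_move:
  assumes "pluses j qs (dual b) = x # q"
  defines "c \<equiv> dual (move j (Suc j) x (dual b))"
  shows "length (minuses i [Suc j, j] b) = length (minuses i [Suc j, j] c)"
    "length (pluses i [Suc j, j] b) = length (pluses i [Suc j, j] c)"
proof -
  have "length (minuses i [Suc j, j] b) = length (minuses i [Suc j, j] c) \<and>
    length (pluses i [Suc j, j] b) = length (pluses i [Suc j, j] c)"
  proof (cases "x \<in> set [i, Suc i]")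
    case True
    obtain q' where "pluses j [i, Suc i] (dual b) = x # q'"
      using hd_pluses_block[OF qs(2)[unfolded qs(1)] assms(1)[unfolded qs(1)] True] by blast
    then show ?thesis
      by (cases "i \<in> b j"; cases "Suc i \<in> b j"; cases "i \<in> b (Suc j)"; cases "Suc i \<in> b (Suc j)")
         (auto simp: c_def move_def)
  next
    case False
    then show ?thesis
      by (simp add: c_def move_def)
  qed
  then show "length (minuses i [Suc j, j] b) = length (minuses i [Suc j, j] c)"
    "length (pluses i [Suc j, j] b) = length (pluses i [Suc j, j] c)" by auto
qed

lemma length_signature_column_move:
  assumes "pluses i ps b = p # q"
  defines "c \<equiv> move i (Suc i) p b"
  shows "length (minuses j [i, Suc i] (dual b)) = length (minuses j [i, Suc i] (dual c))"
    "length (pluses j [i, Suc i] (dual b)) = length (pluses j [i, Suc i] (dual c))"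
proof -
  have "length (minuses j [i, Suc i] (dual b)) = length (minuses j [i, Suc i] (dual c)) \<and>
    length (pluses j [i, Suc i] (dual b)) = length (pluses j [i, Suc i] (dual c))"
  proof (cases "p \<in> set [Suc j, j]")
    case True
    obtain q' where "pluses i [Suc j, j] b = p # q'"
      using hd_pluses_block[OF ps(2)[unfolded ps(1)] assms(1)[unfolded ps(1)] True] by blast
    then show ?thesis
      by (cases "i \<in> b j"; cases "Suc i \<in> b j"; cases "i \<in> b (Suc j)"; cases "Suc i \<in> b (Suc j)")
         (auto simp: c_def move_def)
  next
    case False
    then show ?thesis
      by (simp add: c_def move_def)
  qed
  then show "length (minuses j [i, Suc i] (dual b)) = length (minuses j [i, Suc i] (dual c))"
    "length (pluses j [i, Suc i] (dual b)) = length (pluses j [i, Suc i] (dual c))" by auto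
qed

lemma row_move_outside:
  "p \<in> set us \<union> set ts \<Longrightarrow> dual (move j (Suc j) x (dual b)) p = b p"
  using ps by (auto simp: dual_def move_def)

lemma column_move_outside:
  "x \<in> set us' \<union> set ts' \<Longrightarrow> dual (move i (Suc i) p b) x = dual b x"
  using qs by (auto simp: dual_def move_def)

lemma length_signature_row_move_all:
  assumes "pluses j qs (dual b) = x # q"
  defines "c \<equiv> dual (move j (Suc j) x (dual b))"
  shows "length (minuses i ps b) = length (minuses i ps c)"
    "length (pluses i ps b) = length (pluses i ps c)"
  unfolding ps(1) c_def
  by (rule length_signature_block; use row_move_outside length_signature_row_move[OF assms(1)] in simp)+

lemma length_signature_column_move_all:
  assumes "pluses i ps b = p # q"
  defines "c \<equiv> move i (Suc i) p b"
  shows "length (minuses j qs (dual b)) = length (minuses j qs (dual c))"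
    "length (pluses j qs (dual b)) = length (pluses j qs (dual c))"
  unfolding qs(1) c_def
  by (rule length_signature_block; use column_move_outside length_signature_column_move[OF assms(1)] in simp)+

text \<open>Doing one move first may relocate the other: a single entry of the block, at row
  \<open>j\<close> and column \<open>i\<close>, goes around the square on either side, with
  \<open>p' = Suc j\<close> and \<open>x' = Suc i\<close>. The new positions come from
  \<open>hd_pluses_block_cong\<close>.\<close>

lemma moves_commute:
  assumes p: "pluses i ps b = p # q" and x: "pluses j qs (dual b) = x # r"
  shows "\<exists>p' q' x' r'. pluses i ps (dual (move j (Suc j) x (dual b))) = p' # q' \<and>
    pluses j qs (dual (move i (Suc i) p b)) = x' # r' \<and>
    move i (Suc i) p' (dual (move j (Suc j) x (dual b))) =
    dual (move j (Suc j) x' (dual (move i (Suc i) p b)))"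
proof -
  let ?b1 = "dual (move j (Suc j) x (dual b))" and ?b2 = "move i (Suc i) p b"
  obtain p' q' where p': "pluses i ps ?b1 = p' # q'"
      "if p \<in> set [Suc j, j] then \<exists>q''. pluses i [Suc j, j] ?b1 = p' # q'' else p' = p"
    using hd_pluses_block_cong[OF _ _ _ ps(2)[unfolded ps(1)] p[unfolded ps(1)], of ?b1]
      row_move_outside length_signature_row_move[OF x] unfolding ps(1) by auto
  obtain x' r' where x': "pluses j qs (dual ?b2) = x' # r'"
      "if x \<in> set [i, Suc i] then \<exists>q''. pluses j [i, Suc i] (dual ?b2) = x' # q'' else x' = x"
    using hd_pluses_block_cong[OF _ _ _ qs(2)[unfolded qs(1)] x[unfolded qs(1)], of "dual ?b2"]
      column_move_outside length_signature_column_move[OF p] unfolding qs(1) by auto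
  have pb: "i \<in> b p" "Suc i \<notin> b p" using set_pluses[of p i ps b] p by auto
  have xb: "x \<in> b j" "x \<notin> b (Suc j)" using set_pluses[of x j qs "dual b"] x by auto
  have "move i (Suc i) p' ?b1 = dual (move j (Suc j) x' (dual ?b2))"
  proof (cases "p \<in> set [Suc j, j]")
    case P: True
    obtain q1 where blockp: "pluses i [Suc j, j] b = p # q1"
      using hd_pluses_block[OF ps(2)[unfolded ps(1)] p[unfolded ps(1)] P] by blast
    obtain q2 where blockp': "pluses i [Suc j, j] ?b1 = p' # q2" using p'(2) P by auto
    show ?thesis
    proof (cases "x \<in> set [i, Suc i]")
      case X: True
      obtain q3 where blockx: "pluses j [i, Suc i] (dual b) = x # q3"
        using hd_pluses_block[OF qs(2)[unfolded qs(1)] x[unfolded qs(1)] X] by blast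
      obtain q4 where blockx': "pluses j [i, Suc i] (dual ?b2) = x' # q4" using x'(2) X by auto
      show ?thesis
        using blockp blockp' blockx blockx'
        by (cases "i \<in> b j"; cases "Suc i \<in> b j"; cases "i \<in> b (Suc j)"; cases "Suc i \<in> b (Suc j)")
           (auto simp: move_def dual_def fun_eq_iff)
    next
      case False
      \<comment> \<open>A move in a column outside the block leaves the block unchanged, so both
        positions stay and the moves touch disjoint sets of entries.\<close>
      then have "pluses i [Suc j, j] ?b1 = pluses i [Suc j, j] b"
        by (intro signature_cong) (auto simp: move_def)
      then have "p' = p" "x' = x" using blockp blockp' x'(2) False by auto
      then show ?thesis using False
        by (auto simp: move_def dual_def fun_eq_iff)
    qed
  next
    case P: False
    then have "pluses j [i, Suc i] (dual ?b2) = pluses j [i, Suc i] (dual b)"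
      by (intro signature_cong) (auto simp: move_def)
    then have "x' = x"
      using x'(2) hd_pluses_block[OF qs(2)[unfolded qs(1)] x[unfolded qs(1)]]
      by (metis list.inject)
    moreover have "p' = p" using p'(2) P by auto
    ultimately show ?thesis using P
      by (auto simp: move_def dual_def fun_eq_iff)
  qed
  with p'(1) x'(1) show ?thesis by blast
qed

end


section \<open>Partial maps commuting with crystal operators\<close>

text \<open>Iterates from \<open>b\<close> stay in \<open>C\<close> and \<open>g\<close> carries
  them to those of \<open>h'\<close>, so the predicates under the two \<open>GREATEST\<close>
  agree.\<close>

lemma string_length_cong:
  assumes "b \<in> C"
    and closed: "\<And>x y. x \<in> C \<Longrightarrow> h x = Some y \<Longrightarrow> y \<in> C"
    and comm: "\<And>x. x \<in> C \<Longrightarrow> h' (g x) = map_option g (h x)"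
  shows "string_length h' (g b) = string_length h b"
proof -
  have "set_option (((\<lambda>x. Option.bind x h) ^^ k) (Some b)) \<subseteq> C \<and>
    ((\<lambda>x. Option.bind x h') ^^ k) (Some (g b)) =
      map_option g (((\<lambda>x. Option.bind x h) ^^ k) (Some b))" for k
  proof (induction k)
    case (Suc k)
    then show ?case
      using closed comm by (cases "((\<lambda>x. Option.bind x h) ^^ k) (Some b)") (auto split: option.splits)
  qed (simp add: assms(1))
  then show ?thesis by (simp add: string_length_def)
qed

text \<open>\<open>f_Some\<close> and \<open>None\<close> make definedness of \<open>\<psi>\<close>
  constant along each edge, hence on \<open>C\<close>. Commutation with raising operators is
  recovered from lowering operators by \<open>inverse\<close>; \<open>e_None\<close> supplies only
  the vanishing.\<close>

lemma component_isomorphism: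
  fixes X :: "('b, 'w) crystal"
  assumes closed_f: "\<And>i b c. i \<in> cr_index X \<Longrightarrow> b \<in> cr_elems X \<Longrightarrow> cr_f X i b = Some c \<Longrightarrow> c \<in> cr_elems X"
    and closed_e: "\<And>i b c. i \<in> cr_index X \<Longrightarrow> b \<in> cr_elems X \<Longrightarrow> cr_e X i b = Some c \<Longrightarrow> c \<in> cr_elems X"
    and inverse: "\<And>i b c. i \<in> cr_index X \<Longrightarrow> b \<in> cr_elems X \<Longrightarrow> c \<in> cr_elems X \<Longrightarrow>
      cr_f X i b = Some c \<longleftrightarrow> cr_e X i c = Some b"
    and closed: "\<And>b c. b \<in> cr_elems X \<Longrightarrow> \<psi> b = Some c \<Longrightarrow> c \<in> cr_elems X"
    and inj: "\<And>b b' c. b \<in> cr_elems X \<Longrightarrow> b' \<in> cr_elems X \<Longrightarrow> \<psi> b = Some c \<Longrightarrow> \<psi> b' = Some c \<Longrightarrow> b = b'"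
    and wt: "\<And>b c. b \<in> cr_elems X \<Longrightarrow> \<psi> b = Some c \<Longrightarrow> cr_wt X c = cr_wt X b"
    and f_Some: "\<And>i b c b'. i \<in> cr_index X \<Longrightarrow> b \<in> cr_elems X \<Longrightarrow> \<psi> b = Some c \<Longrightarrow>
      cr_f X i b = Some b' \<Longrightarrow> \<exists>c'. \<psi> b' = Some c' \<and> cr_f X i c = Some c'"
    and f_None: "\<And>i b c. i \<in> cr_index X \<Longrightarrow> b \<in> cr_elems X \<Longrightarrow> \<psi> b = Some c \<Longrightarrow>
      cr_f X i b = None \<Longrightarrow> cr_f X i c = None"
    and e_None: "\<And>i b c. i \<in> cr_index X \<Longrightarrow> b \<in> cr_elems X \<Longrightarrow> \<psi> b = Some c \<Longrightarrow>
      cr_e X i b = None \<Longrightarrow> cr_e X i c = None"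
    and None: "\<And>i b b'. i \<in> cr_index X \<Longrightarrow> b \<in> cr_elems X \<Longrightarrow> \<psi> b = None \<Longrightarrow>
      cr_f X i b = Some b' \<Longrightarrow> \<psi> b' = None"
    and C: "C \<in> connected_components X"
  shows "(\<forall>b\<in>C. \<psi> b = None) \<or> isomorphism_onto_image X C \<psi>"
proof -
  let ?R = "(cr_edges X \<union> (cr_edges X)\<inverse>)\<^sup>*"
  obtain b0 where b0: "b0 \<in> cr_elems X" "C = ?R `` {b0}"
    using C by (auto simp: connected_components_def quotient_def)
  have None_iff: "\<psi> b = None \<longleftrightarrow> \<psi> b' = None" if "(b, b') \<in> cr_edges X" for b b'
  proof -
    from that obtain i where i: "i \<in> cr_index X" "b \<in> cr_elems X" "cr_f X i b = Some b'"
      by (auto simp: cr_edges_def)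
    show ?thesis
      using f_Some[OF i(1,2) _ i(3)] None[OF i(1,2) _ i(3)] by (cases "\<psi> b") auto
  qed
  have inv: "b \<in> cr_elems X \<and> (\<psi> b = None \<longleftrightarrow> \<psi> b0 = None)" if "b \<in> C" for b
  proof -
    have "(b0, b) \<in> ?R" using that b0(2) by simp
    then show ?thesis
    proof (induction rule: rtrancl_induct)
      case (step y z)
      then have "(y, z) \<in> cr_edges X \<or> (z, y) \<in> cr_edges X" by blast
      then show ?case using step.IH None_iff[of y z] None_iff[of z y]
        by (auto simp: cr_edges_def)
    qed (simp add: b0(1))
  qed
  have edge: "b' \<in> C" if "b \<in> C" "(b, b') \<in> cr_edges X \<union> (cr_edges X)\<inverse>" for b b'
    using that b0(2) by (auto intro: rtrancl.rtrancl_into_rtrancl)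
  have Cf: "c \<in> C" if "i \<in> cr_index X" "b \<in> C" "cr_f X i b = Some c" for i b c
  proof -
    have "b \<in> cr_elems X" "c \<in> cr_elems X" using closed_f that inv by blast+
    then have "(b, c) \<in> cr_edges X" using that by (auto simp: cr_edges_def)
    then show ?thesis using edge that by blast
  qed
  have Ce: "c \<in> C" if "i \<in> cr_index X" "b \<in> C" "cr_e X i b = Some c" for i b c
  proof -
    have E: "b \<in> cr_elems X" "c \<in> cr_elems X" using closed_e that inv by blast+
    then have "cr_f X i c = Some b" using inverse that by blast
    then have "(c, b) \<in> cr_edges X" using that E by (auto simp: cr_edges_def)
    then show ?thesis using edge that by blast
  qed
  show ?thesis
  proof (cases "\<psi> b0")
    case None
    then show ?thesis using inv by auto
  next
    case (Some _)
    define g where "g = (\<lambda>b. the (\<psi> b))"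
    have g: "\<psi> b = Some (g b)" if "b \<in> C" for b
      using inv[OF that] Some by (auto simp: g_def)
    have f: "cr_f X i (g b) = map_option g (cr_f X i b)" if "i \<in> cr_index X" "b \<in> C" for i b
    proof (cases "cr_f X i b")
      case None
      then show ?thesis using f_None[OF that(1) _ g] that inv by auto
    next
      case (Some b')
      then show ?thesis
        using f_Some[OF that(1) _ g[OF that(2)] Some] inv[OF that(2)] g[OF Cf[OF that Some]] by auto
    qed
    have e: "cr_e X i (g b) = map_option g (cr_e X i b)" if "i \<in> cr_index X" "b \<in> C" for i b
    proof (cases "cr_e X i b")
      case None
      then show ?thesis using e_None[OF that(1) _ g] that inv by auto
    next
      case (Some b')
      have b': "b' \<in> C" using Ce that Some by blast
      \<comment> \<open>An \<open>e\<close> arrow out of \<open>b\<close> is an \<open>f\<close>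
        arrow from \<open>b'\<close> into \<open>b\<close>; that arrow is transported and inverted
        again.\<close>
      then have "cr_f X i b' = Some b" using inverse that Some inv by blast
      then have "cr_f X i (g b') = Some (g b)" using f[OF that(1) b'] by simp
      moreover have "g b' \<in> cr_elems X" "g b \<in> cr_elems X"
        using closed g inv b' that by blast+
      ultimately have "cr_e X i (g b) = Some (g b')" using inverse[OF that(1)] by blast
      then show ?thesis using Some by simp
    qed
    have "inj_on g C"
      using inj g inv by (intro inj_onI) metis
    moreover have "subcrystal X (g ` C)"
    proof -
      have "g ` C \<subseteq> cr_elems X" using closed g inv by blast
      moreover have "set_option (cr_e X i (g b)) \<subseteq> g ` C" "set_option (cr_f X i (g b)) \<subseteq> g ` C"
        if "i \<in> cr_index X" "b \<in> C" for i b
        using Ce[OF that] Cf[OF that] by (auto simp: e[OF that] f[OF that] option.set_map)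
      ultimately show ?thesis by (auto simp: subcrystal_def)
    qed
    moreover have "cr_eps X i (g b) = cr_eps X i b" "cr_phi X i (g b) = cr_phi X i b"
      if "i \<in> cr_index X" "b \<in> C" for i b
      unfolding cr_eps_def cr_phi_def
      using string_length_cong[OF that(2), of "cr_e X i" "cr_e X i" g]
        string_length_cong[OF that(2), of "cr_f X i" "cr_f X i" g] Ce Cf e f that(1) by blast+
    ultimately show ?thesis
      unfolding isomorphism_onto_image_def crystal_isomorphism_def g_def[symmetric]
      using g wt[OF _ g] inv e f by (auto simp: bij_betw_def cr_eps_def cr_phi_def)
  qed
qed


section \<open>Operators on tensor products of columns\<close>

lemma finite_column_products:
  assumes "b \<in> column_products m n s"
  shows "\<forall>p. finite (b p)"
proof
  fix p
  show "finite (b p)"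
    using assms finite_subset[of "b p" "{1..n}"] by (cases "p \<in> {1..m}") (auto simp: column_products_def)
qed

lemma move_column_products:
  assumes b: "b \<in> column_products m n s" and "x \<in> b p" "y \<notin> b p" "y \<in> {1..n}"
  shows "move x y p b \<in> column_products m n s"
proof -
  have p: "p \<in> {1..m}" using assms by (auto simp: column_products_def)
  have "card (move x y p b q) = card (b q)" for q
    using assms finite_column_products[OF b] card_Suc_Diff1[of "b p" x]
    by (cases "q = p") auto
  then show ?thesis
    using p assms by (auto simp: column_products_def move_def)
qed

lemma lowering_column_products:
  assumes b: "b \<in> column_products m n s" and "lowering ps k b = Some c" "k \<in> {1..n - 1}"
  shows "c \<in> column_products m n s"
proof -
  obtain p q where "pluses k ps b = p # q" "c = move k (Suc k) p b"
    using assms(2) by (auto simp: lowering_Some_iff[OF finite_column_products[OF b]])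
  then show ?thesis
    using set_pluses[of p k ps b] assms(3) by (auto intro!: move_column_products[OF b])
qed

lemma raising_column_products:
  assumes b: "b \<in> column_products m n s" and "raising ps k b = Some c" "k \<in> {1..n - 1}"
  shows "c \<in> column_products m n s"
proof -
  obtain q p where "minuses k ps b = q @ [p]" "c = move (Suc k) k p b"
    using assms(2) by (auto simp: raising_Some_iff[OF finite_column_products[OF b]])
  then show ?thesis
    using set_minuses[of p k ps b] assms(3) by (auto intro!: move_column_products[OF b])
qed

text \<open>A letter occurs at most once per position, so contents are column sums of the matrix
  whose rows are the positions.\<close>

lemma content_eq_card:
  assumes "distinct ps" "\<forall>p. finite (b p)"
  shows "content ps b k = card (set ps \<inter> dual b k)"
  using assms(1)
proof (induction ps)
  case (Cons a ps)
  have "count_list (sorted_list_of_set (b a)) k = (if k \<in> b a then 1 else 0)"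
    using assms(2) by (simp add: count_list_eq_length_filter distinct_length_filter)
  then have "content (a # ps) b k = (if k \<in> b a then 1 else 0) + content ps b k"
    by (simp add: content_def tensor_word_def o_def)
  then show ?case using Cons by (auto simp: Int_insert_left)
qed (simp add: content_def tensor_word_def)

text \<open>A transported move carries a letter from position \<open>x\<close> to position
  \<open>y\<close> without changing it, and both positions are counted.\<close>

lemma content_dual_move:
  assumes "distinct ps" "\<forall>p. finite (b p)" "\<forall>p. finite (c p)"
    and "dual c = move x y p (dual b)" "x \<in> dual b p" "y \<notin> dual b p" "x \<in> set ps" "y \<in> set ps"
  shows "content ps c = content ps b"
proof
  fix k
  have "card (set ps \<inter> insert y (dual b p - {x})) = card (set ps \<inter> dual b p)"
  proof -
    have "set ps \<inter> insert y (dual b p - {x}) = insert y ((set ps \<inter> dual b p) - {x})"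
      using assms by auto
    then show ?thesis using assms card_Suc_Diff1[of "set ps \<inter> dual b p" x] by auto
  qed
  then show "content ps c k = content ps b k"
    using assms by (cases "k = p") (simp_all add: content_eq_card)
qed

section \<open>Transported lowering operators\<close>

lemma dual_op_lowering_Some_iff:
  assumes "\<forall>x. finite (dual b x)"
  shows "dual_op (lowering qs j) b = Some c \<longleftrightarrow>
    (\<exists>x q. pluses j qs (dual b) = x # q \<and> c = dual (move j (Suc j) x (dual b)))"
  by (auto simp: dual_op_def lowering_Some_iff[OF assms])

lemma dual_op_lowering_None_iff:
  assumes "\<forall>x. finite (dual b x)"
  shows "dual_op (lowering qs j) b = None \<longleftrightarrow> pluses j qs (dual b) = []"
  by (auto simp: dual_op_def lowering_None_iff[OF assms])

text \<open>Two abstract reading orders let this serve both halves of the theorem, with the orders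
  interchanged. The block analysis provides \<open>length_f\<close>, \<open>length_dual\<close> and
  \<open>commute\<close>.\<close>

lemma column_crystal_component:
  fixes m n s :: nat and ps qs :: "nat list"
  defines "X \<equiv> \<lparr>cr_index = {1..n-1}, cr_elems = column_products m n s, cr_wt = content ps,
      cr_e = raising ps, cr_f = lowering ps\<rparr>"
  assumes "distinct ps" "distinct qs" "set ps = {1..m}" "k \<in> {1..m - 1}"
    and length_f: "\<And>i b x q. i \<in> {1..n-1} \<Longrightarrow> pluses k qs (dual b) = x # q \<Longrightarrow>
        length (minuses i ps (dual (move k (Suc k) x (dual b)))) = length (minuses i ps b) \<and>
        length (pluses i ps (dual (move k (Suc k) x (dual b)))) = length (pluses i ps b)"
    and length_dual: "\<And>i b p q. i \<in> {1..n-1} \<Longrightarrow> pluses i ps b = p # q \<Longrightarrow>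
        length (pluses k qs (dual (move i (Suc i) p b))) = length (pluses k qs (dual b))"
    and commute: "\<And>i b p q x r. i \<in> {1..n-1} \<Longrightarrow> pluses i ps b = p # q \<Longrightarrow>
        pluses k qs (dual b) = x # r \<Longrightarrow>
        \<exists>p' q' x' r'. pluses i ps (dual (move k (Suc k) x (dual b))) = p' # q' \<and>
          pluses k qs (dual (move i (Suc i) p b)) = x' # r' \<and>
          move i (Suc i) p' (dual (move k (Suc k) x (dual b))) =
          dual (move k (Suc k) x' (dual (move i (Suc i) p b)))"
    and C: "C \<in> connected_components X"
  shows "(\<forall>b\<in>C. dual_op (lowering qs k) b = None) \<or>
    isomorphism_onto_image X C (dual_op (lowering qs k))"
proof -
  let ?E = "column_products m n s" and ?\<psi> = "dual_op (lowering qs k)"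
  have X: "cr_index X = {1..n-1}" "cr_elems X = ?E" "cr_wt X = content ps"
      "cr_e X = raising ps" "cr_f X = lowering ps"
    by (simp_all add: X_def)
  have fin: "\<forall>p. finite (b p)" "\<forall>p. finite (dual b p)" if "b \<in> ?E" for b
    using finite_column_products that dual_column_products by blast+
  note low = lowering_Some_iff[OF fin(1)] lowering_None_iff[OF fin(1)]
    dual_op_lowering_Some_iff[OF fin(2)] dual_op_lowering_None_iff[OF fin(2)]
    raising_None_iff[OF fin(1)]
  have closed_f: "c \<in> ?E" if "i \<in> {1..n-1}" "b \<in> ?E" "lowering ps i b = Some c" for i b c
    using lowering_column_products that by blast
  have closed_e: "c \<in> ?E" if "i \<in> {1..n-1}" "b \<in> ?E" "raising ps i b = Some c" for i b c
    using raising_column_products that by blast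
  have inverse: "lowering ps i b = Some c \<longleftrightarrow> raising ps i c = Some b"
    if "i \<in> {1..n-1}" "b \<in> ?E" "c \<in> ?E" for i b c
    by (rule lowering_raising_iff[OF assms(2)]) (use that fin in auto)
  have closed: "c \<in> ?E" if b: "b \<in> ?E" and c: "?\<psi> b = Some c" for b c
  proof -
    obtain d where "lowering qs k (dual b) = Some d" "c = dual d"
      using c by (auto simp: dual_op_def)
    then show ?thesis
      using lowering_column_products[OF dual_column_products[OF b]] assms(5)
      by (auto intro: dual_column_products)
  qed
  have inj: "b = b'" if b: "b \<in> ?E" "b' \<in> ?E" "?\<psi> b = Some c" "?\<psi> b' = Some c" for b b' c
  proof -
    have c: "c \<in> ?E" using closed b by blast
    have "lowering qs k (dual b) = Some (dual c)" "lowering qs k (dual b') = Some (dual c)"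
      using b by (auto simp: dual_op_def dest: dual_inject)
    then have "raising qs k (dual c) = Some (dual b)" "raising qs k (dual c) = Some (dual b')"
      using lowering_raising_iff[OF assms(3) fin(2) fin(2)] b c by blast+
    then show ?thesis using dual_inject by auto
  qed
  have wt: "content ps c = content ps b" if b: "b \<in> ?E" and c: "?\<psi> b = Some c" for b c
  proof -
    obtain x q where x: "pluses k qs (dual b) = x # q" "c = dual (move k (Suc k) x (dual b))"
      using c b by (auto simp: low)
    then have move: "dual c = move k (Suc k) x (dual b)" "k \<in> dual b x" "Suc k \<notin> dual b x"
      using set_pluses[of x k qs "dual b"] by auto
    have "k \<in> set ps" "Suc k \<in> set ps" using assms(4,5) by auto
    then show ?thesis
      using content_dual_move[OF assms(2) fin(1)[OF b] fin(1)[OF closed[OF b c]] move] by blast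
  qed
  have f_Some: "\<exists>c'. ?\<psi> b' = Some c' \<and> lowering ps i c = Some c'"
    if i: "i \<in> {1..n-1}" and b: "b \<in> ?E" and c: "?\<psi> b = Some c" and b': "lowering ps i b = Some b'"
    for i b c b'
  proof -
    have E: "b' \<in> ?E" "c \<in> ?E" using closed closed_f i b c b' by blast+
    obtain p q where p: "pluses i ps b = p # q" "b' = move i (Suc i) p b"
      using b' b by (auto simp: low)
    obtain x r where x: "pluses k qs (dual b) = x # r" "c = dual (move k (Suc k) x (dual b))"
      using c b by (auto simp: low)
    from commute[OF i p(1) x(1)] obtain p' q' x' r' where
      "pluses i ps c = p' # q'" "pluses k qs (dual b') = x' # r'"
      "move i (Suc i) p' c = dual (move k (Suc k) x' (dual b'))"
      unfolding p(2) x(2) by blast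
    then have "?\<psi> b' = Some (move i (Suc i) p' c)" "lowering ps i c = Some (move i (Suc i) p' c)"
      unfolding low(1)[OF E(2)] low(3)[OF E(1)] by blast+
    then show ?thesis by blast
  qed
  have lengths: "length (minuses i ps c) = length (minuses i ps b)"
      "length (pluses i ps c) = length (pluses i ps b)"
    if i: "i \<in> {1..n-1}" and b: "b \<in> ?E" and c: "?\<psi> b = Some c" for i b c
  proof -
    obtain x r where x: "pluses k qs (dual b) = x # r" "c = dual (move k (Suc k) x (dual b))"
      using c b by (auto simp: low)
    then show "length (minuses i ps c) = length (minuses i ps b)"
        "length (pluses i ps c) = length (pluses i ps b)"
      using length_f[OF i x(1)] by blast+
  qed
  have f_None: "lowering ps i c = None"
    if "i \<in> {1..n-1}" "b \<in> ?E" "?\<psi> b = Some c" "lowering ps i b = None" for i b c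
  proof -
    \<comment> \<open>Lowering vanishes exactly when no \<open>+\<close> survives, so equal counts
      transfer the vanishing; for raising it is the count of \<open>-\<close>.\<close>
    have "pluses i ps b = []" using that(4) unfolding low(2)[OF that(2)] .
    then have "pluses i ps c = []" using lengths(2)[OF that(1-3)] by simp
    then show ?thesis unfolding low(2)[OF closed[OF that(2,3)]] .
  qed
  have e_None: "raising ps i c = None"
    if "i \<in> {1..n-1}" "b \<in> ?E" "?\<psi> b = Some c" "raising ps i b = None" for i b c
  proof -
    have "minuses i ps b = []" using that(4) unfolding low(5)[OF that(2)] .
    then have "minuses i ps c = []" using lengths(1)[OF that(1-3)] by simp
    then show ?thesis unfolding low(5)[OF closed[OF that(2,3)]] .
  qed
  have \<psi>_None: "?\<psi> b' = None"
    if i: "i \<in> {1..n-1}" and b: "b \<in> ?E" and \<psi>: "?\<psi> b = None" and b': "lowering ps i b = Some b'"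
    for i b b'
  proof -
    obtain p q where p: "pluses i ps b = p # q" "b' = move i (Suc i) p b"
      using b' b by (auto simp: low)
    have "pluses k qs (dual b) = []" using \<psi> unfolding low(4)[OF b] .
    then have "pluses k qs (dual b') = []" using length_dual[OF i p(1)] p(2) by simp
    then show ?thesis unfolding low(4)[OF closed_f[OF i b b']] .
  qed
  show ?thesis
    by (rule component_isomorphism[of X ?\<psi> C, unfolded X,
      OF closed_f closed_e inverse closed inj wt f_Some f_None e_None \<psi>_None C])
qed

section \<open>Application to the two crystals\<close>

lemma upt_split_pair: "i \<in> {1..n - 1} \<Longrightarrow> [1..<Suc n] = [1..<i] @ [i, Suc i] @ [Suc (Suc i)..<Suc n]"
  using upt_add_eq_append[of 1 i "Suc n - i"] upt_conv_Cons[of i "Suc n"] upt_conv_Cons[of "Suc i" "Suc n"]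
  by (auto simp del: upt_Suc)

theorem theorem2p21:
  fixes n l s :: nat
  assumes "n \<ge> 2" and "l \<ge> 2"
  shows "(\<forall>j\<in>{1..l-1}. \<forall>C\<in>connected_components (F_crystal n l s).
            (\<forall>b\<in>C. dual_op (fdot_op n j) b = None) \<or>
            isomorphism_onto_image (F_crystal n l s) C (dual_op (fdot_op n j)))
       \<and> (\<forall>i\<in>{1..n-1}. \<forall>C\<in>connected_components (Fdot_crystal n l s).
            (\<forall>d\<in>C. dual_op (f_op l i) d = None) \<or>
            isomorphism_onto_image (Fdot_crystal n l s) C (dual_op (f_op l i)))"
proof (intro conjI ballI)
  have eqs: "f_op l = lowering (F_order l)" "e_op l = raising (F_order l)"
    "fdot_op n = lowering (Fdot_order n)" "edot_op n = raising (Fdot_order n)"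
    by (simp_all add: fun_eq_iff f_op_def e_op_def fdot_op_def edot_op_def)
  \<comment> \<open>Reversal puts \<open>Suc j\<close> before \<open>j\<close>, while the other
    order keeps \<open>i\<close> before \<open>Suc i\<close>, as the block analysis
    requires.\<close>
  have ps: "F_order l = rev [Suc (Suc j)..<Suc l] @ [Suc j, j] @ rev [1..<j]" if "j \<in> {1..l-1}" for j
    by (subst upt_split_pair[OF that]) simp
  have qs: "Fdot_order n = [1..<i] @ [i, Suc i] @ [Suc (Suc i)..<Suc n]" if "i \<in> {1..n-1}" for i
    using upt_split_pair[OF that] .
  have dist: "distinct (F_order l)" "distinct (Fdot_order n)" by auto
  { fix j C assume *: "j \<in> {1..l-1}" "C \<in> connected_components (F_crystal n l s)"
    show "(\<forall>b\<in>C. dual_op (fdot_op n j) b = None) \<or>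
        isomorphism_onto_image (F_crystal n l s) C (dual_op (fdot_op n j))"
      unfolding F_crystal_def F_set_def eqs
    proof (rule column_crystal_component[OF dist _ *(1)])
      fix i b x q assume i: "i \<in> {1..n-1}" and x: "pluses j (Fdot_order n) (dual b) = x # q"
      show "length (minuses i (F_order l) (dual (move j (Suc j) x (dual b)))) =
            length (minuses i (F_order l) b) \<and>
          length (pluses i (F_order l) (dual (move j (Suc j) x (dual b)))) =
            length (pluses i (F_order l) b)"
        using length_signature_row_move_all[OF ps[OF *(1)] dist(1) qs[OF i] dist(2) x] by simp
    next
      fix i b p q assume i: "i \<in> {1..n-1}" and p: "pluses i (F_order l) b = p # q"
      show "length (pluses j (Fdot_order n) (dual (move i (Suc i) p b))) =
          length (pluses j (Fdot_order n) (dual b))"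
        using length_signature_column_move_all[OF ps[OF *(1)] dist(1) qs[OF i] dist(2) p] by simp
    next
      fix i b p q x r
      assume i: "i \<in> {1..n-1}" and p: "pluses i (F_order l) b = p # q"
        and x: "pluses j (Fdot_order n) (dual b) = x # r"
      show "\<exists>p' q' x' r'.
          pluses i (F_order l) (dual (move j (Suc j) x (dual b))) = p' # q' \<and>
          pluses j (Fdot_order n) (dual (move i (Suc i) p b)) = x' # r' \<and>
          move i (Suc i) p' (dual (move j (Suc j) x (dual b))) =
          dual (move j (Suc j) x' (dual (move i (Suc i) p b)))"
        by (rule moves_commute[OF ps[OF *(1)] dist(1) qs[OF i] dist(2) p x])
    qed (use *(2) in \<open>auto simp: F_crystal_def F_set_def eqs\<close>) }
  { fix i C assume *: "i \<in> {1..n-1}" "C \<in> connected_components (Fdot_crystal n l s)"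
    show "(\<forall>d\<in>C. dual_op (f_op l i) d = None) \<or>
        isomorphism_onto_image (Fdot_crystal n l s) C (dual_op (f_op l i))"
      unfolding Fdot_crystal_def Fdot_set_def eqs
    \<comment> \<open>The matrix is now \<open>dual d\<close>: row moves are the crystal operators
      and column moves the transported ones, so the two length lemmas change roles.\<close>
    proof (rule column_crystal_component[OF dist(2,1) _ *(1)])
      fix j d p q assume j: "j \<in> {1..l-1}" and p: "pluses i (F_order l) (dual d) = p # q"
      show "length (minuses j (Fdot_order n) (dual (move i (Suc i) p (dual d)))) =
            length (minuses j (Fdot_order n) d) \<and>
          length (pluses j (Fdot_order n) (dual (move i (Suc i) p (dual d)))) =
            length (pluses j (Fdot_order n) d)"
        using length_signature_column_move_all[OF ps[OF j] dist(1) qs[OF *(1)] dist(2) p] by simp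
    next
      fix j d x q assume j: "j \<in> {1..l-1}" and x: "pluses j (Fdot_order n) d = x # q"
      show "length (pluses i (F_order l) (dual (move j (Suc j) x d))) =
          length (pluses i (F_order l) (dual d))"
        using length_signature_row_move_all[OF ps[OF j] dist(1) qs[OF *(1)] dist(2), of "dual d"] x by simp
    next
      fix j d x r p q
      assume j: "j \<in> {1..l-1}" and x: "pluses j (Fdot_order n) d = x # r"
        and p: "pluses i (F_order l) (dual d) = p # q"
      obtain p' q' x' r' where
        "pluses i (F_order l) (dual (move j (Suc j) x d)) = p' # q'"
        "pluses j (Fdot_order n) (dual (move i (Suc i) p (dual d))) = x' # r'"
        "move i (Suc i) p' (dual (move j (Suc j) x d)) =
          dual (move j (Suc j) x' (dual (move i (Suc i) p (dual d))))"
        using moves_commute[OF ps[OF j] dist(1) qs[OF *(1)] dist(2) p] x by auto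
      \<comment> \<open>Dualizing both sides and exchanging them gives the required form of the
        equation.\<close>
      then show "\<exists>x' r' p' q'.
          pluses j (Fdot_order n) (dual (move i (Suc i) p (dual d))) = x' # r' \<and>
          pluses i (F_order l) (dual (move j (Suc j) x d)) = p' # q' \<and>
          move j (Suc j) x' (dual (move i (Suc i) p (dual d))) =
          dual (move i (Suc i) p' (dual (move j (Suc j) x d)))"
        by (metis dual_dual)
    qed (use *(2) in \<open>auto simp: Fdot_crystal_def Fdot_set_def eqs\<close>) }
qed

end
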